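(* For any weak Roman graph $G$ and any graph $H$ such that $\gamma_r(H)=2$, $$\gamma_r(G\circ H)=2\gamma(G).$$
   Context: Graphs are finite, simple and undirected. For a graph $G$, a function $f:V(G)\to\{0,1,2\}$ has weight $w(f)=\sum_{v\in V(G)}f(v)$; a vertex $v$ is undefended with respect to $f$ if $f(v)=0$ and $f(u)=0$ for every $u$ adjacent to $v$. The function $f$ is a weak Roman dominating function (WRDF) on $G$ if for every $v$ with $f(v)=0$ there is a vertex $u$ adjacent to $v$ with $f(u)\in\{1,2\}$ such that the function $f'$ defined by $f'(v)=1$, $f'(u)=f(u)-1$ and $f'(z)=f(z)$ for $z\notin\{u,v\}$ has no undefended vertices. The weak Roman domination number $\gamma_r(G)$ is the minimum weight of a WRDF on $G$. The lexicographic product $G\circ H$ has vertex set $V(G)\times V(H)$, and $(u,v)$ and $(x,y)$ are adjacent iff $ux\in E(G)$, or $u=x$ and $vy\in E(H)$. The domination number $\gamma(G)$ is the minimum cardinality of a set $D\subseteq V(G)$ such that every vertex outside $D$ has a neighbour in $D$. A graph $G$ is a weak Roman graph if $\gamma_r(G)=2\gamma(G)$. *)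

theory Defs
  imports "Graph_Theory.Graph_Theory"
begin

text \<open>
  Finite simple undirected graphs are rendered by the locale predicate \<open>pair_graph\<close>: finitely many
  vertices, no loops, and a symmetric arc relation, so that an edge \<open>uv\<close> is the pair of arcs
  \<open>(u, v)\<close>, \<open>(v, u)\<close>. The null graph is admitted.

  A function \<open>V(G) \<rightarrow> {0,1,2}\<close> is a total function into \<open>nat\<close> whose values off \<open>V(G)\<close> are irrelevant.
\<close>

definition weight :: "'a pair_pre_digraph \<Rightarrow> ('a \<Rightarrow> nat) \<Rightarrow> nat" where
  "weight G f = (\<Sum>v\<in>pverts G. f v)"

definition undefended :: "'a pair_pre_digraph \<Rightarrow> ('a \<Rightarrow> nat) \<Rightarrow> 'a \<Rightarrow> bool" where
  "undefended G f v \<longleftrightarrow>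
     v \<in> pverts G \<and> f v = 0 \<and> (\<forall>u. (u, v) \<in> parcs G \<longrightarrow> f u = 0)"

definition WRDF :: "'a pair_pre_digraph \<Rightarrow> ('a \<Rightarrow> nat) \<Rightarrow> bool" where
  "WRDF G f \<longleftrightarrow>
     (\<forall>v\<in>pverts G. f v \<in> {0, 1, 2}) \<and>
     (\<forall>v\<in>pverts G. f v = 0 \<longrightarrow>
        (\<exists>u. (u, v) \<in> parcs G \<and> f u \<in> {1, 2} \<and>
             \<not> (\<exists>z. undefended G (f(v := 1, u := f u - 1)) z)))"

definition weak_roman_number :: "'a pair_pre_digraph \<Rightarrow> nat" where
  "weak_roman_number G = (LEAST k. \<exists>f. WRDF G f \<and> weight G f = k)"

definition dominating_set :: "'a pair_pre_digraph \<Rightarrow> 'a set \<Rightarrow> bool" where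
  "dominating_set G D \<longleftrightarrow>
     D \<subseteq> pverts G \<and> (\<forall>v\<in>pverts G - D. \<exists>u\<in>D. (u, v) \<in> parcs G)"

definition domination_number :: "'a pair_pre_digraph \<Rightarrow> nat" where
  "domination_number G = (LEAST k. \<exists>D. dominating_set G D \<and> card D = k)"

definition weak_roman_graph :: "'a pair_pre_digraph \<Rightarrow> bool" where
  "weak_roman_graph G \<longleftrightarrow>
     pair_graph G \<and> weak_roman_number G = 2 * domination_number G"

definition lex_product ::
    "'a pair_pre_digraph \<Rightarrow> 'b pair_pre_digraph \<Rightarrow> ('a \<times> 'b) pair_pre_digraph" where
  "lex_product G H =
     \<lparr> pverts = pverts G \<times> pverts H,
       parcs = {((u, v), (x, y)) | u v x y.
                  (u, v) \<in> pverts G \<times> pverts H \<and> (x, y) \<in> pverts G \<times> pverts H \<and>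
                  ((u, x) \<in> parcs G \<or> u = x \<and> (v, y) \<in> parcs H)} \<rparr>"

lemma pair_graph_lex_product:
  assumes "pair_graph G" and "pair_graph H"
  shows "pair_graph (lex_product G H)"
proof -
  interpret G: pair_graph G by fact
  interpret H: pair_graph H by fact
  have sG: "(x, u) \<in> parcs G" if "(u, x) \<in> parcs G" for u x
    using G.pair_sym_arcs that unfolding symmetric_def by (auto dest: symD)
  have sH: "(x, u) \<in> parcs H" if "(u, x) \<in> parcs H" for u x
    using H.pair_sym_arcs that unfolding symmetric_def by (auto dest: symD)
  have nG: "(u, u) \<notin> parcs G" for u using G.pair_no_loops by force
  have nH: "(u, u) \<notin> parcs H" for u using H.pair_no_loops by force
  let ?V = "pverts G \<times> pverts H"
  have fV: "finite ?V" by (simp add: G.pair_finite_verts H.pair_finite_verts)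
  have "parcs (lex_product G H) \<subseteq> ?V \<times> ?V" by (auto simp: lex_product_def)
  then have fA: "finite (parcs (lex_product G H))"
    using fV finite_SigmaI finite_subset by blast
  show ?thesis
  proof unfold_locales
    show "finite (pverts (lex_product G H))" using fV by (simp add: lex_product_def)
    show "symmetric (with_proj (lex_product G H))"
      unfolding symmetric_def by (auto simp: lex_product_def sym_def intro: sG sH)
  qed (use fA nG nH in \<open>auto simp: lex_product_def\<close>)
qed

text \<open>Both minima range over nonempty sets, so \<open>LEAST\<close> is attained.\<close>

lemma WRDF_const_1: "WRDF G (\<lambda>_. 1)"
  by (simp add: WRDF_def)

lemma weak_roman_number_attained: "\<exists>f. WRDF G f \<and> weight G f = weak_roman_number G"
  unfolding weak_roman_number_def by (rule LeastI_ex) (use WRDF_const_1 in blast)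

lemma dominating_set_pverts: "dominating_set G (pverts G)"
  by (simp add: dominating_set_def)

lemma domination_number_attained: "\<exists>D. dominating_set G D \<and> card D = domination_number G"
  unfolding domination_number_def by (rule LeastI_ex) (use dominating_set_pverts in blast)

end

theory Submission
  imports Defs
begin

text \<open>
  Lower bound: collapsing a WRDF of \<open>G \<circ> H\<close> to \<open>u \<mapsto> min 2 (weight of the copy of H over u)\<close> gives a
  WRDF of \<open>G\<close> of no larger weight, so \<open>\<gamma>\<^sub>r(G \<circ> H) \<ge> \<gamma>\<^sub>r(G) = 2 \<gamma>(G)\<close>.
  Upper bound: put a WRDF of \<open>H\<close> of weight 2 on each copy of \<open>H\<close> over a minimum dominating set of
  \<open>G\<close>. An attack inside such a copy is answered inside the copy; any other attack is answered from
  an adjacent such copy, which keeps one of its two units.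
\<close>

lemma no_undefended_iff:
  "\<not> (\<exists>z. undefended G f z) \<longleftrightarrow>
     (\<forall>z\<in>pverts G. f z = 0 \<longrightarrow> (\<exists>u. (u, z) \<in> parcs G \<and> f u > 0))"
  by (auto simp: undefended_def)

lemma WRDF_D:
  assumes "WRDF G f" "v \<in> pverts G" "f v = 0"
  obtains u where "(u, v) \<in> parcs G" "f u > 0"
    "\<And>z. z \<in> pverts G \<Longrightarrow> (f(v := 1, u := f u - 1)) z = 0 \<Longrightarrow>
       \<exists>w. (w, z) \<in> parcs G \<and> (f(v := 1, u := f u - 1)) w > 0"
proof -
  obtain u where u: "(u, v) \<in> parcs G" "f u \<in> {1, 2}"
    "\<not> (\<exists>z. undefended G (f(v := 1, u := f u - 1)) z)"
    using assms unfolding WRDF_def by blast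
  show thesis
    by (rule that[of u]) (use u in \<open>auto simp only: no_undefended_iff\<close>)
qed

text \<open>Membership of the defender in \<open>pverts G\<close> is demanded because
  \<open>G\<close> is an arbitrary \<open>pair_pre_digraph\<close> here, whose arcs may leave its
  vertex set. It lets the bound 2 apply to the defender, so positivity alone yields a value in
  \<open>{1, 2}\<close>.\<close>

lemma WRDF_I:
  assumes "\<And>v. v \<in> pverts G \<Longrightarrow> f v \<le> 2"
    and "\<And>v. v \<in> pverts G \<Longrightarrow> f v = 0 \<Longrightarrow>
      \<exists>u\<in>pverts G. (u, v) \<in> parcs G \<and> f u > 0 \<and>
        (\<forall>z\<in>pverts G. (f(v := 1, u := f u - 1)) z = 0 \<longrightarrow>
           (\<exists>w. (w, z) \<in> parcs G \<and> (f(v := 1, u := f u - 1)) w > 0))"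
  shows "WRDF G f"
  unfolding WRDF_def no_undefended_iff
proof (intro conjI ballI impI)
  have val: "f v \<in> {0, 1, 2}" if "v \<in> pverts G" for v
    using assms(1)[OF that] by auto
  show "f v \<in> {0, 1, 2}" if "v \<in> pverts G" for v
    using val[OF that] .
  fix v assume "v \<in> pverts G" "f v = 0"
  from assms(2)[OF this] obtain u where u: "u \<in> pverts G" "(u, v) \<in> parcs G" "f u > 0"
    "\<forall>z\<in>pverts G. (f(v := 1, u := f u - 1)) z = 0 \<longrightarrow>
       (\<exists>w. (w, z) \<in> parcs G \<and> (f(v := 1, u := f u - 1)) w > 0)" by blast
  moreover have "f u \<in> {1, 2}" using val[OF u(1)] u(3) by auto
  ultimately show "\<exists>u. (u, v) \<in> parcs G \<and> f u \<in> {1, 2} \<and>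
      (\<forall>z\<in>pverts G. (f(v := 1, u := f u - 1)) z = 0 \<longrightarrow>
         (\<exists>w. (w, z) \<in> parcs G \<and> (f(v := 1, u := f u - 1)) w > 0))" by blast
qed

lemma weak_roman_number_le: "WRDF G f \<Longrightarrow> weak_roman_number G \<le> weight G f"
  unfolding weak_roman_number_def by (rule Least_le) blast

lemma pverts_lex_product [simp]: "pverts (lex_product G H) = pverts G \<times> pverts H"
  by (simp add: lex_product_def)

lemma parcs_lex_product:
  "((u, v), (x, y)) \<in> parcs (lex_product G H) \<longleftrightarrow>
     u \<in> pverts G \<and> v \<in> pverts H \<and> x \<in> pverts G \<and> y \<in> pverts H \<and>
     ((u, x) \<in> parcs G \<or> u = x \<and> (v, y) \<in> parcs H)"
  by (auto simp: lex_product_def)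

lemma weight_lex_product:
  "weight (lex_product G H) f = (\<Sum>u\<in>pverts G. \<Sum>v\<in>pverts H. f (u, v))"
  by (simp add: weight_def sum.cartesian_product)

lemma weak_roman_number_lex_product_ge:
  assumes "pair_graph G" "pair_graph H" "pverts H \<noteq> {}"
  shows "weak_roman_number G \<le> weak_roman_number (lex_product G H)"
proof -
  interpret G: pair_graph G by fact
  interpret H: pair_graph H by fact
  obtain f where f: "WRDF (lex_product G H) f"
    "weight (lex_product G H) f = weak_roman_number (lex_product G H)"
    using weak_roman_number_attained by blast
  define S where "S u = (\<Sum>v\<in>pverts H. f (u, v))" for u
  \<comment> \<open>The cap keeps the values in {0,1,2} and never raises the weight. A zero of
    \<open>g\<close> still means that the whole copy over \<open>u\<close> carries zeros.\<close>
  define g where "g u = min 2 (S u)" for u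
  have S_ge: "f (u, v) \<le> S u" if "v \<in> pverts H" for u v
    unfolding S_def using that H.pair_finite_verts by (intro member_le_sum) auto
  \<comment> \<open>Two different positive vertices in one copy force the value 2 of
    \<open>g\<close>; this serves below when the second guard sits beside the defender.\<close>
  have S_ge2: "f (u, v) + f (u, w) \<le> S u" if "v \<in> pverts H" "w \<in> pverts H" "v \<noteq> w" for u v w
  proof -
    have "sum (\<lambda>v. f (u, v)) {v, w} \<le> S u"
      unfolding S_def using that H.pair_finite_verts by (intro sum_mono2) auto
    then show ?thesis using that by simp
  qed
  have zero: "f (u, v) = 0" if "g u = 0" "v \<in> pverts H" for u v
    using S_ge[OF that(2), of u] that(1) by (auto simp: g_def min_def split: if_splits)
  have sym: "(x, u) \<in> parcs G" if "(u, x) \<in> parcs G" for u x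
    using G.pair_sym_arcs that unfolding symmetric_def by (auto dest: symD)
  \<comment> \<open>A fixed vertex of \<open>H\<close> turns each attack on \<open>u\<close> into
    the attack on \<open>(u, v)\<close>. For a null \<open>H\<close> the product has weak Roman
    domination number 0.\<close>
  obtain v where v: "v \<in> pverts H" using assms by blast
  have "WRDF G g"
  proof (rule WRDF_I)
    fix u assume u: "u \<in> pverts G" "g u = 0"
    have uv: "(u, v) \<in> pverts (lex_product G H)" "f (u, v) = 0"
      using u v zero by auto
    from WRDF_D[OF f(1) uv] obtain p where p:
      "(p, (u, v)) \<in> parcs (lex_product G H)" "f p > 0"
      "\<And>z. z \<in> pverts (lex_product G H) \<Longrightarrow> (f((u, v) := 1, p := f p - 1)) z = 0 \<Longrightarrow>
         \<exists>w. (w, z) \<in> parcs (lex_product G H) \<and> (f((u, v) := 1, p := f p - 1)) w > 0"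
      by blast
    obtain x y where [simp]: "p = (x, y)" by (cases p)
    have x: "x \<in> pverts G" and y: "y \<in> pverts H" using p(1) by (auto simp: parcs_lex_product)
    \<comment> \<open>The copy over \<open>u\<close> carries only zeros, so the defender of
      \<open>(u, v)\<close> lies in another copy and projects to a neighbour of
      \<open>u\<close>.\<close>
    have "x \<noteq> u" using zero[OF u(2) y] p(2) by auto
    then have xu: "(x, u) \<in> parcs G" using p(1) by (auto simp: parcs_lex_product)
    have gx: "g x > 0" using S_ge[OF y, of x] p(2) by (simp add: g_def)
    define g' where "g' = g(u := 1, x := g x - 1)"
    have "\<exists>w. (w, z) \<in> parcs G \<and> g' w > 0" if z: "z \<in> pverts G" "g' z = 0" for z
    \<comment> \<open>The move may empty \<open>x\<close>, but \<open>x\<close> and all other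
      neighbours of \<open>u\<close> are now guarded by the unit on \<open>u\<close>.\<close>
    proof (cases "z = x \<or> (u, z) \<in> parcs G")
      case True
      then have "(u, z) \<in> parcs G" "g' u > 0" using sym[OF xu] \<open>x \<noteq> u\<close> by (auto simp: g'_def)
      then show ?thesis by blast
    next
      case False
      have zu: "z \<noteq> u" using z(2) \<open>x \<noteq> u\<close> by (auto simp: g'_def)
      have gz: "g z = 0" using z(2) zu False by (auto simp: g'_def)
      \<comment> \<open>The move does not touch the copy over \<open>z\<close>, which is all zero.
        Hence the guard \<open>q\<close> of \<open>(z, v)\<close> lies over a neighbour
        \<open>w\<close> of \<open>z\<close>, and \<open>w\<close> is not \<open>u\<close> because
        \<open>u\<close> is not adjacent to \<open>z\<close>.\<close>
      have "(f((u, v) := 1, p := f p - 1)) (z, v) = 0"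
        using zero[OF gz v] zu False by auto
      then obtain q where q: "(q, (z, v)) \<in> parcs (lex_product G H)"
        "(f((u, v) := 1, p := f p - 1)) q > 0"
        using p(3)[of "(z, v)"] z(1) v by auto
      obtain w t where [simp]: "q = (w, t)" by (cases q)
      have t: "t \<in> pverts H" using q(1) by (auto simp: parcs_lex_product)
      have "w \<noteq> z" using q(2) zero[OF gz t] zu False by auto
      then have wz: "(w, z) \<in> parcs G" using q(1) by (auto simp: parcs_lex_product)
      then have "w \<noteq> u" using False by auto
      have "g' w > 0"
      proof (cases "w = x")
        case True
        \<comment> \<open>The vertex \<open>q\<close> stays positive after \<open>p\<close> has
          given up a unit: either \<open>q\<close> is \<open>p\<close>, which then held 2, or both
          are positive. So \<open>g x = 2\<close>, and one unit is left on \<open>x\<close>.\<close>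
        have "S x \<ge> 2"
        proof (cases "t = y")
          case True
          then show ?thesis using q(2) \<open>w = x\<close> S_ge[OF y, of x] by auto
        next
          case False
          then show ?thesis using q(2) \<open>w = x\<close> \<open>w \<noteq> u\<close> S_ge2[OF y t, of x] p(2) by auto
        qed
        then show ?thesis using True by (simp add: g'_def g_def)
      next
        case False
        then show ?thesis
          using q(2) S_ge[OF t, of w] \<open>w \<noteq> u\<close> by (simp add: g'_def g_def)
      qed
      then show ?thesis using wz by blast
    qed
    then show "\<exists>x\<in>pverts G. (x, u) \<in> parcs G \<and> g x > 0 \<and>
        (\<forall>z\<in>pverts G. (g(u := 1, x := g x - 1)) z = 0 \<longrightarrow>
           (\<exists>w. (w, z) \<in> parcs G \<and> (g(u := 1, x := g x - 1)) w > 0))"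
      using x xu gx unfolding g'_def by blast
  qed (simp add: g_def)
  then have "weak_roman_number G \<le> weight G g" by (rule weak_roman_number_le)
  also have "\<dots> \<le> weight (lex_product G H) f"
    unfolding weight_lex_product unfolding weight_def by (intro sum_mono) (simp add: g_def S_def)
  finally show ?thesis using f(2) by simp
qed

text \<open>The value 2 enters twice: it makes the total weight \<open>2 * card D\<close>, and it
  leaves a unit in a copy that has sent one away.\<close>

lemma weak_roman_number_lex_product_le:
  assumes "pair_graph G" "pair_graph H" "weak_roman_number H = 2"
  shows "weak_roman_number (lex_product G H) \<le> 2 * domination_number G"
proof -
  interpret G: pair_graph G by fact
  interpret H: pair_graph H by fact
  obtain h where h: "WRDF H h" and h2: "(\<Sum>v\<in>pverts H. h v) = 2"
    using weak_roman_number_attained[of H] assms(3) by (auto simp: weight_def)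
  obtain D where D: "dominating_set G D" and cD: "card D = domination_number G"
    using domination_number_attained by blast
  have DG: "D \<subseteq> pverts G" using D by (simp add: dominating_set_def)
  have symG: "(x, u) \<in> parcs G" if "(u, x) \<in> parcs G" for u x
    using G.pair_sym_arcs that unfolding symmetric_def by (auto dest: symD)
  have vH: "u \<in> pverts H \<and> v \<in> pverts H" if "(u, v) \<in> parcs H" for u v
    using H.in_arcsD1 H.in_arcsD2 that by blast
  obtain a where a: "a \<in> pverts H" "h a > 0"
    using h2 by (metis neq0_conv sum.neutral zero_neq_numeral)
  \<comment> \<open>Removing one unit at \<open>a\<close> leaves weight 1, which sits on some
    \<open>b\<close>, possibly \<open>a\<close> itself. This \<open>b\<close> will guard the copies
    adjacent to the one that sends a defender.\<close>
  have "\<exists>b\<in>pverts H. (h(a := h a - 1)) b > 0"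
  proof (rule ccontr)
    assume "\<not> ?thesis"
    then have "(\<Sum>v\<in>pverts H. (h(a := h a - 1)) v) = 0" by (intro sum.neutral) auto
    moreover have "(\<Sum>v\<in>pverts H. h v) = h a + (\<Sum>v\<in>pverts H - {a}. h v)"
      using a H.pair_finite_verts by (intro sum.remove) auto
    moreover have "(\<Sum>v\<in>pverts H. (h(a := h a - 1)) v)
        = h a - 1 + (\<Sum>v\<in>pverts H - {a}. h v)"
      using a H.pair_finite_verts by (subst sum.remove[of _ a]) auto
    ultimately show False using h2 a by simp
  qed
  then obtain b where b: "b \<in> pverts H" "(h(a := h a - 1)) b > 0" by blast
  define f where "f = (\<lambda>(u, v). if u \<in> D then h v else 0)"
  have "WRDF (lex_product G H) f"
  proof (rule WRDF_I)
    fix p assume p: "p \<in> pverts (lex_product G H)"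
    then show "f p \<le> 2" using h by (force simp: f_def WRDF_def)
    obtain u v where [simp]: "p = (u, v)" by (cases p)
    have u: "u \<in> pverts G" and v: "v \<in> pverts H" using p by auto
    assume fp: "f p = 0"
    \<comment> \<open>Copies over \<open>D\<close> other than the defending one are untouched, hence dominate themselves
      and every copy adjacent to them.\<close>
    have defended: "\<exists>r. (r, (x, y)) \<in> parcs (lex_product G H) \<and> (f(p := 1, q := f q - 1)) r > 0"
      if q: "fst q = d" "d \<in> D" and
        x: "x \<in> pverts G" "x \<noteq> d" "(d, x) \<notin> parcs G" and y: "y \<in> pverts H"
        and 0: "(f(p := 1, q := f q - 1)) (x, y) = 0" for x y d q
    proof (cases "x \<in> D")
      case True
      have "h y = 0" using 0 x q True by (auto simp: f_def split: if_splits)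
      then obtain y' where "(y', y) \<in> parcs H" "h y' > 0" using WRDF_D[OF h y] by blast
      then show ?thesis using x y q True vH
        by (intro exI[of _ "(x, y')"]) (auto simp: f_def parcs_lex_product)
    next
      case False
      then obtain e where e: "e \<in> D" "(e, x) \<in> parcs G"
        using D x unfolding dominating_set_def by blast
      then have "e \<noteq> d" using x by auto
      then show ?thesis using e a x y q DG
        by (intro exI[of _ "(e, a)"]) (auto simp: f_def parcs_lex_product)
    qed
    show "\<exists>q\<in>pverts (lex_product G H). (q, p) \<in> parcs (lex_product G H) \<and> f q > 0 \<and>
        (\<forall>z\<in>pverts (lex_product G H). (f(p := 1, q := f q - 1)) z = 0 \<longrightarrow>
           (\<exists>r. (r, z) \<in> parcs (lex_product G H) \<and> (f(p := 1, q := f q - 1)) r > 0))"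
    proof (cases "u \<in> D")
      case True
      then have "h v = 0" using fp by (simp add: f_def)
      from WRDF_D[OF h v this] obtain t where t: "(t, v) \<in> parcs H" "h t > 0"
        "\<And>z. z \<in> pverts H \<Longrightarrow> (h(v := 1, t := h t - 1)) z = 0 \<Longrightarrow>
           \<exists>w. (w, z) \<in> parcs H \<and> (h(v := 1, t := h t - 1)) w > 0" by blast
      have tv: "t \<noteq> v" using \<open>h v = 0\<close> t(2) by auto
      have tH: "t \<in> pverts H" using t(1) vH by blast
      define f' where "f' = f(p := 1, (u, t) := f (u, t) - 1)"
      \<comment> \<open>Over \<open>u\<close> the move is exactly the one that \<open>h\<close>
        makes in \<open>H\<close>, so this copy remains guarded from within. The copies adjacent to
        it are guarded by \<open>(u, v)\<close>, which now holds 1.\<close>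
      have f'u: "f' (u, y) = (h(v := 1, t := h t - 1)) y" for y
        using True by (auto simp: f'_def f_def)
      have "\<exists>r. (r, (x, y)) \<in> parcs (lex_product G H) \<and> f' r > 0"
        if x: "x \<in> pverts G" and y: "y \<in> pverts H" and 0: "f' (x, y) = 0" for x y
      proof (cases "x = u")
        case True
        then obtain w where w: "(w, y) \<in> parcs H" "(h(v := 1, t := h t - 1)) w > 0"
          using t(3)[OF y] 0 f'u by auto
        then have "f' (u, w) > 0" by (simp only: f'u)
        then show ?thesis using w(1) True u y vH
          by (intro exI[of _ "(u, w)"]) (auto simp: parcs_lex_product)
      next
        case xu: False
        show ?thesis
        proof (cases "(u, x) \<in> parcs G")
          case True
          moreover have "f' (u, v) > 0" using tv by (simp add: f'u)
          ultimately show ?thesis using u v x y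
            by (intro exI[of _ "(u, v)"]) (auto simp: parcs_lex_product)
        next
          case False
          show ?thesis
            using defended[of "(u, t)" u x y] True x xu False y 0 unfolding f'_def by simp
        qed
      qed
      then show ?thesis
        using True t tH u v
        by (intro bexI[of _ "(u, t)"]) (auto simp: parcs_lex_product f_def f'_def)
    next
      case False
      then obtain d where d: "d \<in> D" "(d, u) \<in> parcs G"
        using D u unfolding dominating_set_def by blast
      have dG: "d \<in> pverts G" and du: "d \<noteq> u" using d DG False by auto
      define f' where "f' = f(p := 1, (d, a) := f (d, a) - 1)"
      have f'd: "f' (d, y) = (h(a := h a - 1)) y" for y
        using du d by (auto simp: f'_def f_def)
      have "\<exists>r. (r, (x, y)) \<in> parcs (lex_product G H) \<and> f' r > 0"
        if x: "x \<in> pverts G" and y: "y \<in> pverts H" and 0: "f' (x, y) = 0" for x y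
      proof (cases "x = d")
        \<comment> \<open>The copy over \<open>d\<close> may no longer dominate itself, but all its
          vertices are adjacent to \<open>(u, v)\<close>, where the unit has gone.\<close>
        case True
        moreover have "f' (u, v) > 0" using du by (simp add: f'_def)
        ultimately show ?thesis using symG[OF d(2)] u v x y
          by (intro exI[of _ "(u, v)"]) (auto simp: parcs_lex_product)
      next
        case xd: False
        show ?thesis
        proof (cases "(d, x) \<in> parcs G")
          case True
          moreover have "f' (d, b) > 0" using b(2) by (simp only: f'd)
          ultimately show ?thesis using dG b(1) x y
            by (intro exI[of _ "(d, b)"]) (auto simp: parcs_lex_product)
        next
          case False
          show ?thesis
            using defended[of "(d, a)" d x y] d x xd False y 0 unfolding f'_def by simp
        qed
      qed
      then show ?thesis
        using d dG a u v
        by (intro bexI[of _ "(d, a)"]) (auto simp: parcs_lex_product f_def f'_def)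
    qed
  qed
  then have "weak_roman_number (lex_product G H) \<le> weight (lex_product G H) f"
    by (rule weak_roman_number_le)
  also have "\<dots> = (\<Sum>u\<in>pverts G. if u \<in> D then 2 else 0)"
    unfolding weight_lex_product by (intro sum.cong) (auto simp: f_def h2)
  also have "\<dots> = 2 * card D"
    using G.pair_finite_verts DG by (simp add: sum.If_cases Int_absorb1)
  finally show ?thesis using cD by simp
qed

theorem theorem27:
  fixes G :: "'a pair_pre_digraph" and H :: "'b pair_pre_digraph"
  assumes "weak_roman_graph G"
    and "pair_graph H"
    and "weak_roman_number H = 2"
  shows "weak_roman_number (lex_product G H) = 2 * domination_number G"
proof (rule antisym)
  have G: "pair_graph G" "weak_roman_number G = 2 * domination_number G"
    using assms(1) by (auto simp: weak_roman_graph_def)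
  \<comment> \<open>On the null graph every function has weight 0, not 2.\<close>
  have "pverts H \<noteq> {}"
    using weak_roman_number_attained[of H] assms(3) by (auto simp: weight_def)
  then show "2 * domination_number G \<le> weak_roman_number (lex_product G H)"
    using weak_roman_number_lex_product_ge[OF G(1) assms(2)] G(2) by simp
  show "weak_roman_number (lex_product G H) \<le> 2 * domination_number G"
    using weak_roman_number_lex_product_le[OF G(1) assms(2,3)] .
qed

end
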